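(* Let $c$ be a constraint over variables with domain $[1,d]$ that has a binary decomposition. Then unit-propagation on the support encoding of $c$ (with $c$ required to hold) enforces arc consistency on the binary decomposition of $c$.
   Context: Constraints. Variables have domain $[1,d]=\{1,\dots,d\}$. A constraint $c$ has a scope $\mathrm{scope}(c)=(v_1,\dots,v_n)$ of variables and a relation $\mathrm{range}(c)\subseteq[1,d]^n$ of allowed tuples. A binary decomposition of $c$ is a set of binary constraints on pairs of variables of $\mathrm{scope}(c)$ whose conjunction is equivalent to $c$ (a binary constraint is its own decomposition); take exactly one binary constraint for each pair of distinct variables (the full relation if the pair is unconstrained). Given current domains $D(v)\subseteq[1,d]$, a binary constraint on $v,v'$ is arc consistent iff for each $a\in D(v)$ there is a compatible $b\in D(v')$, and vice versa. Enforcing arc consistency means replacing the domains by the largest subdomains for which all binary constraints considered are arc consistent; failure means that some domain becomes empty. Logic programs and unit-propagation. A rule $h\leftarrow a_1,\dots,a_m,\mathit{not}\,a_{m+1},\dots,\mathit{not}\,a_k$ has head $h$ and body the set of literals on its right; $\bot$ is the always-false atom. A choice rule $\{h_1,\dots,h_k\}\leftarrow$ leaves $h_1,\dots,h_k$ free. A cardinality body $k\{\ell_1,\dots,\ell_m\}$ holds iff at least $k$ of the literals $\ell_j$ hold. Unit-propagation works on partial truth assignments to atoms and rule bodies, using the nogoods (forbidden sets of truth-value assignments) expressing that: a body is true iff its literals are all true (for a cardinality body: iff at least $k$ of its literals are true, expressed by one nogood per relevant subset of literals); a true body makes its head true; an atom is true only if the body of some rule having it in its head is true; $\bot$ is false.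 Whenever all but one element of a nogood hold, the complement of the remaining element is added; a conflict occurs if all elements of some nogood hold. Support encoding of $c$. For each $v\in\mathrm{scope}(c)$ there are atoms $e(v,i)$, $1\le i\le d$ (meaning $v=i$), and the rules $\{e(v,1),\dots,e(v,d)\}\leftarrow$; $\ \bot\leftarrow \mathit{not}\,e(v,1),\dots,\mathit{not}\,e(v,d)$; $\ \bot\leftarrow 2\{e(v,1),\dots,e(v,d)\}$. In addition there are the rules $sat(c)\leftarrow\mathit{not}\,violate(c)$ and $violate(c)\leftarrow\mathit{not}\,sat(c)$. For each ordered pair of distinct variables $v,v'\in\mathrm{scope}(c)$ and each value $i\in[1,d]$, let $\{i_1,\dots,i_m\}\subseteq[1,d]$ be the support of $v=i$ in $v'$, i.e. the set of values of $v'$ that are compatible with $v=i$ in the binary constraint on $v,v'$; the encoding contains the rule $violate(c)\leftarrow e(v,i),\mathit{not}\,e(v',i_1),\dots,\mathit{not}\,e(v',i_m)$. Enforcing a consistency by unit-propagation. Given nonempty initial domains $D(v)\subseteq[1,d]$, start from the assignment in which $violate(c)$ is false and $e(v,i)$ is false for all $i\notin D(v)$, and run unit-propagation to fixpoint. That unit-propagation enforces arc consistency means: for all such initial domains, a conflict occurs iff enforcing arc consistency fails, and otherwise, for every $v$, the set of $i$ with $e(v,i)$ not false at the fixpoint equals the domain of $v$ obtained by enforcing arc consistency. *)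

theory Defs
  imports Main
begin

section \<open>Constraints and arc consistency\<close>

datatype 'v constraint =
  Constraint (scope: "'v list") (allowed: "nat list set")

definition is_constraint :: "nat \<Rightarrow> 'v constraint \<Rightarrow> bool" where
  "is_constraint d c \<longleftrightarrow>
     (\<forall>t\<in>allowed c. length t = length (scope c) \<and> set t \<subseteq> {1..d})"

definition satisfies :: "('v \<Rightarrow> nat) \<Rightarrow> 'v constraint \<Rightarrow> bool" where
  "satisfies s c \<longleftrightarrow> map s (scope c) \<in> allowed c"

text \<open>
  The second conjunct says that there is exactly one binary constraint for each unordered pair
  of distinct variables; its scope may list the two variables in either order.
\<close>

definition binary_decomposition :: "nat \<Rightarrow> 'v constraint \<Rightarrow> 'v constraint set \<Rightarrow> bool" where
  "binary_decomposition d c B \<longleftrightarrow>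
     (\<forall>b\<in>B. is_constraint d b \<and>
        (\<exists>v v'. scope b = [v, v'] \<and> v \<noteq> v' \<and> v \<in> set (scope c) \<and> v' \<in> set (scope c))) \<and>
     (\<forall>v\<in>set (scope c). \<forall>v'\<in>set (scope c). v \<noteq> v' \<longrightarrow>
        (\<exists>!b. b \<in> B \<and> set (scope b) = {v, v'})) \<and>
     (\<forall>s. (\<forall>v\<in>set (scope c). s v \<in> {1..d}) \<longrightarrow>
        (satisfies s c \<longleftrightarrow> (\<forall>b\<in>B. satisfies s b)))"

definition compatible :: "'v constraint set \<Rightarrow> 'v \<Rightarrow> nat \<Rightarrow> 'v \<Rightarrow> nat \<Rightarrow> bool" where
  "compatible B v i v' j \<longleftrightarrow>
     (\<exists>b\<in>B. scope b = [v, v'] \<and> [i, j] \<in> allowed b \<or>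
            scope b = [v', v] \<and> [j, i] \<in> allowed b)"

text \<open>Only meaningful for binary constraints.\<close>

definition arc_consistent :: "('v \<Rightarrow> nat set) \<Rightarrow> 'v constraint \<Rightarrow> bool" where
  "arc_consistent D b \<longleftrightarrow>
     (\<forall>v v'. scope b = [v, v'] \<longrightarrow>
        (\<forall>i\<in>D v. \<exists>j\<in>D v'. [i, j] \<in> allowed b) \<and>
        (\<forall>j\<in>D v'. \<exists>i\<in>D v. [i, j] \<in> allowed b))"

definition enforce_ac :: "'v constraint set \<Rightarrow> ('v \<Rightarrow> nat set) \<Rightarrow> 'v \<Rightarrow> nat set" where
  "enforce_ac B D = (GREATEST E. E \<le> D \<and> (\<forall>b\<in>B. arc_consistent E b))"

text \<open>The greatest element exists, because arc-consistent subdomains are closed under unions.\<close>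

lemma arc_consistent_Sup:
  assumes "\<forall>E\<in>X. arc_consistent E b"
  shows "arc_consistent (Sup X) b"
  unfolding arc_consistent_def
proof (intro allI impI conjI ballI)
  fix v v' i assume sc: "scope b = [v, v']" and "i \<in> Sup X v"
  then obtain E where E: "E \<in> X" "i \<in> E v" by auto
  then obtain j where "j \<in> E v'" "[i, j] \<in> allowed b"
    using sc assms unfolding arc_consistent_def by blast
  with E show "\<exists>j\<in>Sup X v'. [i, j] \<in> allowed b" by auto
next
  fix v v' j assume sc: "scope b = [v, v']" and "j \<in> Sup X v'"
  then obtain E where E: "E \<in> X" "j \<in> E v'" by auto
  then obtain i where "i \<in> E v" "[i, j] \<in> allowed b"
    using sc assms unfolding arc_consistent_def by blast
  with E show "\<exists>i\<in>Sup X v. [i, j] \<in> allowed b" by auto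
qed

lemma enforce_ac_eq_Sup: "enforce_ac B D = Sup {E. E \<le> D \<and> (\<forall>b\<in>B. arc_consistent E b)}"
  unfolding enforce_ac_def
proof (rule Greatest_equality)
  let ?X = "{E. E \<le> D \<and> (\<forall>b\<in>B. arc_consistent E b)}"
  have "Sup ?X \<le> D" by (rule Sup_least) simp
  then show "Sup ?X \<le> D \<and> (\<forall>b\<in>B. arc_consistent (Sup ?X) b)"
    by (simp add: arc_consistent_Sup)
next
  fix E assume "E \<le> D \<and> (\<forall>b\<in>B. arc_consistent E b)"
  then show "E \<le> Sup {E. E \<le> D \<and> (\<forall>b\<in>B. arc_consistent E b)}"
    by (intro Sup_upper) simp
qed

section \<open>Logic programs and their nogoods\<close>

text \<open>\<open>Val v i\<close> is the atom $e(v,i)$.\<close>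

datatype 'v atom = Bot | Val 'v nat | Sat "'v constraint" | Violate "'v constraint"

datatype 'v literal = Pos (atom_of: "'v atom") | Neg (atom_of: "'v atom")

text \<open>\<open>AtLeast k L\<close> is the cardinality body $k\{L\}$.\<close>

datatype 'v body =
  Conj (literals: "'v literal set") | AtLeast nat (literals: "'v literal set")

datatype 'v rule =
  Rule "'v atom" (body: "'v body") | Choice "'v atom set" (body: "'v body")

primrec heads :: "'v rule \<Rightarrow> 'v atom set" where
  "heads (Rule h b) = {h}"
| "heads (Choice H b) = H"

definition atoms :: "'v rule set \<Rightarrow> 'v atom set" where
  "atoms P = (\<Union>r\<in>P. heads r \<union> atom_of ` literals (body r))"

text \<open>
  Assignments are sets of entries stating that an atom or body is true (\<open>T\<close>) or false (\<open>F\<close>).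
\<close>

datatype 'v item = Atom "'v atom" | Body "'v body"

datatype 'v signed = T "'v item" | F "'v item"

primrec complement :: "'v signed \<Rightarrow> 'v signed" where
  "complement (T x) = F x"
| "complement (F x) = T x"

primrec holds :: "'v literal \<Rightarrow> 'v signed" where
  "holds (Pos a) = T (Atom a)"
| "holds (Neg a) = F (Atom a)"

definition fails :: "'v literal \<Rightarrow> 'v signed" where
  "fails l = complement (holds l)"

text \<open>
  A cardinality body with \<open>m\<close> literals is false as soon as \<open>m + 1 - k\<close> of them are.  For
  \<open>k > m\<close> the truncated difference is 0, which yields the nogood forbidding the body to be true.
\<close>

primrec body_nogoods :: "'v body \<Rightarrow> 'v signed set set" where
  "body_nogoods (Conj L) =
     {insert (F (Body (Conj L))) (holds ` L)} \<union>
     {{T (Body (Conj L)), fails l} | l. l \<in> L}"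
| "body_nogoods (AtLeast k L) =
     {insert (F (Body (AtLeast k L))) (holds ` S) | S. S \<subseteq> L \<and> card S = k} \<union>
     {insert (T (Body (AtLeast k L))) (fails ` S) | S. S \<subseteq> L \<and> card S = card L + 1 - k}"

definition nogoods :: "'v rule set \<Rightarrow> 'v signed set set" where
  "nogoods P =
     (\<Union>r\<in>P. body_nogoods (body r)) \<union>
     {{T (Body b), F (Atom h)} | h b. Rule h b \<in> P} \<union>
     {insert (T (Atom a)) {F (Body (body r)) | r. r \<in> P \<and> a \<in> heads r} | a. a \<in> atoms P} \<union>
     {{T (Atom Bot)}}"

section \<open>Unit-propagation\<close>

text \<open>
  The closure is not stopped at a conflict.  It may therefore become inconsistent, but only if some
  nogood is contained in it (for a consistent initial assignment), and otherwise it is the fixpoint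
  reached by every maximal sequence of propagation steps.
\<close>

inductive_set unit_propagation :: "'v signed set set \<Rightarrow> 'v signed set \<Rightarrow> 'v signed set"
  for N :: "'v signed set set" and I :: "'v signed set" where
  initial: "x \<in> I \<Longrightarrow> x \<in> unit_propagation N I"
| propagate: "\<delta> \<in> N \<Longrightarrow> x \<in> \<delta> \<Longrightarrow> \<forall>y\<in>\<delta> - {x}. y \<in> unit_propagation N I \<Longrightarrow>
    complement x \<in> unit_propagation N I"

definition conflict :: "'v signed set set \<Rightarrow> 'v signed set \<Rightarrow> bool" where
  "conflict N A \<longleftrightarrow> (\<exists>\<delta>\<in>N. \<delta> \<subseteq> A)"

section \<open>Support encoding\<close>

definition support :: "nat \<Rightarrow> 'v constraint set \<Rightarrow> 'v \<Rightarrow> nat \<Rightarrow> 'v \<Rightarrow> nat set" where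
  "support d B v i v' = {j\<in>{1..d}. compatible B v i v' j}"

definition value_rules :: "nat \<Rightarrow> 'v \<Rightarrow> 'v rule set" where
  "value_rules d v =
     {Choice {Val v i | i. i \<in> {1..d}} (Conj {}),
      Rule Bot (Conj {Neg (Val v i) | i. i \<in> {1..d}}),
      Rule Bot (AtLeast 2 {Pos (Val v i) | i. i \<in> {1..d}})}"

definition support_encoding :: "nat \<Rightarrow> 'v constraint \<Rightarrow> 'v constraint set \<Rightarrow> 'v rule set" where
  "support_encoding d c B =
     (\<Union>v\<in>set (scope c). value_rules d v) \<union>
     {Rule (Sat c) (Conj {Neg (Violate c)}), Rule (Violate c) (Conj {Neg (Sat c)})} \<union>
     {Rule (Violate c) (Conj (insert (Pos (Val v i)) {Neg (Val v' j) | j. j \<in> support d B v i v'}))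
       | v v' i. v \<in> set (scope c) \<and> v' \<in> set (scope c) \<and> v \<noteq> v' \<and> i \<in> {1..d}}"

definition initial_assignment :: "nat \<Rightarrow> 'v constraint \<Rightarrow> ('v \<Rightarrow> nat set) \<Rightarrow> 'v signed set" where
  "initial_assignment d c D =
     insert (F (Atom (Violate c)))
       {F (Atom (Val v i)) | v i. v \<in> set (scope c) \<and> i \<in> {1..d} \<and> i \<notin> D v}"

text \<open>
  \<open>P\<close> is the logic program encoding \<open>c\<close>, and \<open>B\<close> the set of binary constraints
  on which arc consistency is to be enforced.
\<close>

definition up_enforces_ac ::
    "nat \<Rightarrow> 'v constraint \<Rightarrow> 'v rule set \<Rightarrow> 'v constraint set \<Rightarrow> bool" where
  "up_enforces_ac d c P B \<longleftrightarrow>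
     (\<forall>D. (\<forall>v\<in>set (scope c). D v \<noteq> {} \<and> D v \<subseteq> {1..d}) \<longrightarrow>
        (let A = unit_propagation (nogoods P) (initial_assignment d c D) in
          (conflict (nogoods P) A \<longleftrightarrow> (\<exists>v\<in>set (scope c). enforce_ac B D v = {})) \<and>
          (\<not> conflict (nogoods P) A \<longrightarrow>
             (\<forall>v\<in>set (scope c).
                {i\<in>{1..d}. F (Atom (Val v i)) \<notin> A} = enforce_ac B D v))))"

end

(*
  Let E be the result of enforcing arc consistency on the initial domains D.  The values not falsified
  by unit-propagation form arc-consistent subdomains of D, since the constraint nogoods remove every
  value without support; hence they are contained in E, and an empty domain of E makes the
  at-least-one nogood of that variable conflicting.  Conversely, if all domains of E are nonempty, then
  the partial assignment falsifying exactly the values outside E, and making true the values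
  of singleton domains, leaves every nogood with a violated element or with two unassigned
  ones.  Hence unit-propagation never leaves this assignment and meets no conflict.
*)

theory Submission
  imports Defs
begin

section \<open>Arc consistency\<close>

lemma enforce_ac_le: "enforce_ac B D \<le> D"
  unfolding enforce_ac_eq_Sup by (rule Sup_least) simp

lemma arc_consistent_enforce_ac: "b \<in> B \<Longrightarrow> arc_consistent (enforce_ac B D) b"
  unfolding enforce_ac_eq_Sup by (rule arc_consistent_Sup) simp

lemma le_enforce_ac: "E \<le> D \<Longrightarrow> \<forall>b\<in>B. arc_consistent E b \<Longrightarrow> E \<le> enforce_ac B D"
  unfolding enforce_ac_eq_Sup by (rule Sup_upper) simp

section \<open>Compatibility of values and the binary constraints of a decomposition\<close>

lemma compatible_sym: "compatible B v i v' j \<longleftrightarrow> compatible B v' j v i"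
  unfolding compatible_def by blast

lemma binary_decomposition_scopeE:
  assumes "binary_decomposition d c B" "b \<in> B"
  obtains v v' where "scope b = [v, v']" "v \<noteq> v'" "v \<in> set (scope c)" "v' \<in> set (scope c)"
  using assms unfolding binary_decomposition_def by blast

lemma binary_decomposition_scopeD:
  assumes "binary_decomposition d c B" "b \<in> B" "scope b = [v, v']"
  shows "v \<noteq> v'" "v \<in> set (scope c)" "v' \<in> set (scope c)"
proof -
  obtain w w' where "scope b = [w, w']" "w \<noteq> w'" "w \<in> set (scope c)" "w' \<in> set (scope c)"
    using assms(1,2) by (rule binary_decomposition_scopeE)
  then show "v \<noteq> v'" "v \<in> set (scope c)" "v' \<in> set (scope c)" using assms(3) by auto
qed

lemma binary_decomposition_unique_constraint:
  assumes "binary_decomposition d c B" "v \<in> set (scope c)" "v' \<in> set (scope c)" "v \<noteq> v'"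
  shows "\<exists>!b. b \<in> B \<and> set (scope b) = {v, v'}"
proof -
  have "\<forall>v\<in>set (scope c). \<forall>v'\<in>set (scope c). v \<noteq> v' \<longrightarrow> (\<exists>!b. b \<in> B \<and> set (scope b) = {v, v'})"
    using assms(1) unfolding binary_decomposition_def by (elim conjE)
  then show ?thesis using assms(2-4) by simp
qed

lemma binary_decomposition_obtains_constraint:
  assumes "binary_decomposition d c B" "v \<in> set (scope c)" "v' \<in> set (scope c)" "v \<noteq> v'"
  obtains b where "b \<in> B" "scope b = [v, v'] \<or> scope b = [v', v]"
proof -
  obtain b where b: "b \<in> B" "set (scope b) = {v, v'}"
    using binary_decomposition_unique_constraint[OF assms] by blast
  obtain w w' where "scope b = [w, w']" using assms(1) b(1) by (rule binary_decomposition_scopeE)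
  then show thesis using b that[of b] by (auto simp: doubleton_eq_iff)
qed

text \<open>The decomposition has only one constraint on each pair of variables, so the existential
  in \<open>compatible\<close> can only be witnessed by \<open>b\<close>; since \<open>v\<close> and
  \<open>v'\<close> differ, the reversed orientation of the scope is excluded.\<close>

lemma compatible_iff_allowed:
  assumes "binary_decomposition d c B" "b \<in> B" "scope b = [v, v']"
  shows "compatible B v i v' j \<longleftrightarrow> [i, j] \<in> allowed b"
proof -
  have v: "v \<noteq> v'" "v \<in> set (scope c)" "v' \<in> set (scope c)"
    using binary_decomposition_scopeD[OF assms] by simp_all
  have unique: "b' = b" if "b' \<in> B" "set (scope b') = {v, v'}" for b'
  proof -
    have "b \<in> B \<and> set (scope b) = {v, v'}" using assms by simp
    then show ?thesis using binary_decomposition_unique_constraint[OF assms(1) v(2,3,1)] that by blast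
  qed
  show ?thesis
  proof
    assume "compatible B v i v' j"
    then obtain b' where b': "b' \<in> B"
        "scope b' = [v, v'] \<and> [i, j] \<in> allowed b' \<or> scope b' = [v', v] \<and> [j, i] \<in> allowed b'"
      unfolding compatible_def by blast
    moreover have "b' = b" using b' by (intro unique) auto
    ultimately show "[i, j] \<in> allowed b" using assms(3) v(1) by auto
  qed (use assms in \<open>auto simp: compatible_def\<close>)
qed

text \<open>This removes the orientation of scopes: quantifying over ordered pairs covers both
  directions of each constraint, so one direction per pair suffices. Ordered pairs are also what the
  support rules are indexed by.\<close>

lemma all_arc_consistent_iff:
  assumes "binary_decomposition d c B"
  shows "(\<forall>b\<in>B. arc_consistent E b) \<longleftrightarrow>
    (\<forall>v\<in>set (scope c). \<forall>v'\<in>set (scope c). v \<noteq> v' \<longrightarrow>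
       (\<forall>i\<in>E v. \<exists>j\<in>E v'. compatible B v i v' j))" (is "?L \<longleftrightarrow> ?R")
proof
  assume L: ?L
  show ?R
  proof (intro ballI impI)
    fix v v' i assume v: "v \<in> set (scope c)" "v' \<in> set (scope c)" "v \<noteq> v'" and i: "i \<in> E v"
    from assms v obtain b where b: "b \<in> B" "scope b = [v, v'] \<or> scope b = [v', v]"
      by (rule binary_decomposition_obtains_constraint)
    from b(2) show "\<exists>j\<in>E v'. compatible B v i v' j"
    proof
      assume sc: "scope b = [v, v']"
      then show ?thesis
        using L b(1) i compatible_iff_allowed[OF assms b(1) sc] unfolding arc_consistent_def by blast
    next
      assume sc: "scope b = [v', v]"
      then show ?thesis
        using L b(1) i compatible_iff_allowed[OF assms b(1) sc] compatible_sym[of B v i v']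
        unfolding arc_consistent_def by blast
    qed
  qed
next
  assume R: ?R
  show ?L
  proof
    fix b assume b: "b \<in> B"
    show "arc_consistent E b"
      unfolding arc_consistent_def
    proof (intro allI impI)
      fix v v' assume sc: "scope b = [v, v']"
      have v: "v \<in> set (scope c)" "v' \<in> set (scope c)" "v \<noteq> v'"
        using binary_decomposition_scopeD[OF assms b sc] by simp_all
      show "(\<forall>i\<in>E v. \<exists>j\<in>E v'. [i, j] \<in> allowed b) \<and> (\<forall>j\<in>E v'. \<exists>i\<in>E v. [i, j] \<in> allowed b)"
        unfolding compatible_iff_allowed[OF assms b sc, symmetric]
      proof (intro conjI ballI)
        show "\<exists>j\<in>E v'. compatible B v i v' j" if "i \<in> E v" for i
          using R v that by blast
        show "\<exists>i\<in>E v. compatible B v i v' j" if "j \<in> E v'" for j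
          unfolding compatible_sym[of B v _ v'] using R v(1,2) v(3)[symmetric] that by blast
      qed
    qed
  qed
qed

section \<open>Assignments that unit-propagation cannot leave\<close>

text \<open>The invariant behind two watched literals: a nogood of this kind is either already
  defused by \<open>M\<close> or too far from being unit, so no part of a consistent
  \<open>M\<close> can make it yield an entry outside \<open>M\<close>.\<close>

definition inert :: "'v signed set \<Rightarrow> 'v signed set \<Rightarrow> bool" where
  "inert M \<delta> \<longleftrightarrow> (\<exists>y\<in>\<delta>. complement y \<in> M) \<or> (\<exists>y\<in>\<delta>. \<exists>z\<in>\<delta>. y \<noteq> z \<and> y \<notin> M \<and> z \<notin> M)"

lemma inert_if_complement: "y \<in> \<delta> \<Longrightarrow> complement y \<in> M \<Longrightarrow> inert M \<delta>"
  unfolding inert_def by blast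

lemma inert_if_two: "y \<in> \<delta> \<Longrightarrow> z \<in> \<delta> \<Longrightarrow> y \<noteq> z \<Longrightarrow> y \<notin> M \<Longrightarrow> z \<notin> M \<Longrightarrow> inert M \<delta>"
  unfolding inert_def by blast

text \<open>By induction, all elements of the firing nogood except \<open>x\<close> lie in
  \<open>M\<close>. Two elements outside \<open>M\<close> are then impossible, and by consistency of
  \<open>M\<close> the element with its complement in \<open>M\<close> must be \<open>x\<close>, so
  the derived entry is already there.\<close>

lemma unit_propagation_subset:
  assumes "I \<subseteq> M" "\<forall>\<delta>\<in>N. inert M \<delta>" "\<forall>x\<in>M. complement x \<notin> M"
  shows "unit_propagation N I \<subseteq> M"
proof
  fix x assume "x \<in> unit_propagation N I"
  then show "x \<in> M"
  proof induction
    case (propagate \<delta> x)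
    then have others: "y \<in> M" if "y \<in> \<delta>" "y \<noteq> x" for y using that by blast
    have "inert M \<delta>" using assms(2) propagate(1) by blast
    then show ?case
      unfolding inert_def
    proof (elim disjE bexE conjE)
      fix y assume "y \<in> \<delta>" "complement y \<in> M"
      then show ?thesis using others[of y] assms(3) by (cases "y = x") auto
    next
      fix y z assume "y \<in> \<delta>" "z \<in> \<delta>" "y \<noteq> z" "y \<notin> M" "z \<notin> M"
      then show ?thesis using others[of y] others[of z] by metis
    qed
  qed (use assms in auto)
qed

lemma no_conflict_if_inert:
  assumes "I \<subseteq> M" "\<forall>\<delta>\<in>N. inert M \<delta>" "\<forall>x\<in>M. complement x \<notin> M"
  shows "\<not> conflict N (unit_propagation N I)"
proof
  assume "conflict N (unit_propagation N I)"
  then obtain \<delta> where "\<delta> \<in> N" "\<delta> \<subseteq> M"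
    using unit_propagation_subset[OF assms] unfolding conflict_def by blast
  moreover from this have "inert M \<delta>" using assms(2) by blast
  ultimately show False using assms(3) unfolding inert_def by blast
qed

section \<open>The assignment induced by arc-consistent domains\<close>

text \<open>An upper bound for what propagation can derive. Singleton values must be true because
  the at-least-one nogood derives them. Every body gets a truth value, so that of the atoms and
  bodies of the encoding only values in domains with several elements stay open.\<close>

definition ac_assignment :: "'v constraint \<Rightarrow> ('v \<Rightarrow> nat set) \<Rightarrow> 'v signed set" where
  "ac_assignment c E =
     {F (Atom Bot), F (Atom (Violate c)), T (Atom (Sat c))} \<union>
     {F (Atom (Val v i)) | v i. i \<notin> E v} \<union> {T (Atom (Val v i)) | v i. E v = {i}} \<union>
     {T (Body b) | b. b \<in> {Conj {}, Conj {Neg (Violate c)}}} \<union>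
     {F (Body b) | b. b \<notin> {Conj {}, Conj {Neg (Violate c)}}}"

lemma ac_assignment_simps [simp]:
  "F (Atom Bot) \<in> ac_assignment c E"
  "F (Atom (Violate c)) \<in> ac_assignment c E"
  "T (Atom (Sat c)) \<in> ac_assignment c E"
  "F (Atom (Val v i)) \<in> ac_assignment c E \<longleftrightarrow> i \<notin> E v"
  "T (Atom (Val v i)) \<in> ac_assignment c E \<longleftrightarrow> E v = {i}"
  "T (Body b) \<in> ac_assignment c E \<longleftrightarrow> b = Conj {} \<or> b = Conj {Neg (Violate c)}"
  "F (Body b) \<in> ac_assignment c E \<longleftrightarrow> b \<noteq> Conj {} \<and> b \<noteq> Conj {Neg (Violate c)}"
  unfolding ac_assignment_def by auto

lemma ac_assignment_consistent: "\<forall>x\<in>ac_assignment c E. complement x \<notin> ac_assignment c E"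
  unfolding ac_assignment_def by auto

text \<open>A sole remaining value is true in the assignment, which violates its element of the
  nogood; two remaining values give two elements outside the assignment.\<close>

lemma inert_at_least_one:
  assumes "E v \<noteq> {}" "\<forall>i\<in>E v. F (Atom (Val v i)) \<in> \<delta>"
  shows "inert (ac_assignment c E) \<delta>"
proof -
  obtain k where k: "k \<in> E v" using assms(1) by blast
  show ?thesis
  proof (cases "E v = {k}")
    case True
    then show ?thesis using assms(2) k by (intro inert_if_complement[of "F (Atom (Val v k))"]) auto
  next
    case False
    then obtain k' where "k' \<in> E v" "k' \<noteq> k" using k by blast
    then show ?thesis using assms(2) k
      by (intro inert_if_two[of "F (Atom (Val v k))" _ "F (Atom (Val v k'))"]) auto
  qed
qed

text \<open>If both values remain, the domain is no singleton and neither is true; otherwise one of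
  them is false.\<close>

lemma inert_at_most_one:
  assumes "T (Atom (Val v i)) \<in> \<delta>" "T (Atom (Val v j)) \<in> \<delta>" "i \<noteq> j"
  shows "inert (ac_assignment c E) \<delta>"
proof (cases "i \<in> E v \<and> j \<in> E v")
  case True
  then show ?thesis using assms
    by (intro inert_if_two[of "T (Atom (Val v i))" _ "T (Atom (Val v j))"]) auto
next
  case False
  then show ?thesis using assms inert_if_complement[of "T (Atom (Val v i))" \<delta>]
      inert_if_complement[of "T (Atom (Val v j))" \<delta>] by auto
qed

text \<open>A remaining value \<open>i\<close> of \<open>v\<close> has a remaining support
  \<open>j\<close>. If \<open>j\<close> is the only value of \<open>v'\<close>, it is true and
  defuses the nogood. Otherwise a second element outside the assignment is needed besides
  \<open>j\<close>: it is \<open>i\<close> itself when \<open>v\<close> has other values, and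
  another value of \<open>v'\<close> when it has none.\<close>

lemma inert_support:
  assumes ij: "\<forall>i\<in>E v. \<exists>j\<in>E v'. compatible B v i v' j"
    and ji: "\<forall>j\<in>E v'. \<exists>i\<in>E v. compatible B v i v' j"
    and "E v' \<subseteq> {1..d}"
    and val: "T (Atom (Val v i)) \<in> \<delta>" and sup: "\<forall>j\<in>support d B v i v'. F (Atom (Val v' j)) \<in> \<delta>"
  shows "inert (ac_assignment c E) \<delta>"
proof (cases "i \<in> E v")
  case False
  then show ?thesis using val by (intro inert_if_complement[of "T (Atom (Val v i))"]) auto
next
  case True
  then obtain j where j: "j \<in> E v'" "compatible B v i v' j" using ij by blast
  then have Fj: "F (Atom (Val v' j)) \<in> \<delta>" using sup assms(3) by (auto simp: support_def)
  consider "E v' = {j}" | "E v \<noteq> {i}" | j' where "E v = {i}" "j' \<in> E v'" "j' \<noteq> j"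
    using j by blast
  then show ?thesis
  proof cases
    case 1
    then show ?thesis using Fj by (intro inert_if_complement[of "F (Atom (Val v' j))"]) auto
  next
    case 2
    then show ?thesis using Fj val j
      by (intro inert_if_two[of "F (Atom (Val v' j))" _ "T (Atom (Val v i))"]) auto
  next
    case 3
    \<comment> \<open>Arc consistency from \<open>v'\<close> to \<open>v\<close> gives
      \<open>j'\<close> a compatible value, which can only be \<open>i\<close>; hence
      \<open>j'\<close> also belongs to the support of \<open>i\<close>.\<close>
    then have "F (Atom (Val v' j')) \<in> \<delta>" using ji sup assms(3) by (fastforce simp: support_def)
    then show ?thesis using Fj j 3
      by (intro inert_if_two[of "F (Atom (Val v' j))" _ "F (Atom (Val v' j'))"]) auto
  qed
qed

section \<open>Inertness of all nogoods of the encoding\<close>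

lemma support_encodingE:
  assumes "r \<in> support_encoding d c B"
  obtains (choice) v where "v \<in> set (scope c)" "r = Choice {Val v i | i. i \<in> {1..d}} (Conj {})"
  | (at_least_one) v where "v \<in> set (scope c)" "r = Rule Bot (Conj {Neg (Val v i) | i. i \<in> {1..d}})"
  | (at_most_one) v where "v \<in> set (scope c)"
      "r = Rule Bot (AtLeast 2 {Pos (Val v i) | i. i \<in> {1..d}})"
  | (sat) "r = Rule (Sat c) (Conj {Neg (Violate c)})"
  | (violate) "r = Rule (Violate c) (Conj {Neg (Sat c)})"
  | (support) v v' i where "v \<in> set (scope c)" "v' \<in> set (scope c)" "v \<noteq> v'" "i \<in> {1..d}"
      "r = Rule (Violate c)
             (Conj (insert (Pos (Val v i)) {Neg (Val v' j) | j. j \<in> support d B v i v'}))"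
  using assms unfolding support_encoding_def value_rules_def by blast

text \<open>All but two bodies are false in the assignment, which defuses every nogood that contains
  such a body as true. What remains for each of these rules are the nogoods with the body false and
  enough literals true, treated by the preceding lemmas.\<close>

lemma inert_body_nogoods:
  assumes dec: "binary_decomposition d c B" and ac: "\<forall>b\<in>B. arc_consistent E b"
    and E: "\<forall>v\<in>set (scope c). E v \<noteq> {} \<and> E v \<subseteq> {1..d}"
    and r: "r \<in> support_encoding d c B" and \<delta>: "\<delta> \<in> body_nogoods (body r)"
  shows "inert (ac_assignment c E) \<delta>"
proof -
  have *: ?thesis if "T (Body (body r)) \<in> \<delta>" "body r \<noteq> Conj {}" "body r \<noteq> Conj {Neg (Violate c)}"
    using that by (intro inert_if_complement) auto
  have comp: "\<forall>i\<in>E v. \<exists>j\<in>E v'. compatible B v i v' j"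
    if "v \<in> set (scope c)" "v' \<in> set (scope c)" "v \<noteq> v'" for v v'
    using ac that unfolding all_arc_consistent_iff[OF dec] by blast
  from r show ?thesis
  proof (cases rule: support_encodingE)
    case (choice v)
    then have "\<delta> = {F (Body (Conj {}))}" using \<delta> by auto
    then show ?thesis by (intro inert_if_complement) auto
  next
    case (at_least_one v)
    \<comment> \<open>A nonempty domain forces d >= 1. For d = 0 the at-least-one body would be
      \<open>Conj {}\<close>, which the assignment makes true.\<close>
    obtain k where "k \<in> {1..d}" using E at_least_one(1) by blast
    then have "{Neg (Val v i) | i. i \<in> {1..d}} \<noteq> {}" by blast
    then have ne: "body r \<noteq> Conj {}" "body r \<noteq> Conj {Neg (Violate c)}"
      using at_least_one by auto
    show ?thesis
    proof (cases "T (Body (body r)) \<in> \<delta>")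
      case False
      with \<delta> at_least_one have \<delta>_eq: "\<delta> = insert (F (Body (body r))) (holds ` {Neg (Val v i) | i. i \<in> {1..d}})"
        by auto
      have "F (Atom (Val v i)) \<in> \<delta>" if "i \<in> {1..d}" for i
        unfolding \<delta>_eq using that by (intro insertI2 image_eqI[of _ _ "Neg (Val v i)"]) auto
      moreover have "E v \<noteq> {}" "E v \<subseteq> {1..d}" using E at_least_one(1) by blast+
      ultimately show ?thesis by (intro inert_at_least_one[of E v]) blast+
    qed (use * ne in auto)
  next
    case (at_most_one v)
    show ?thesis
    proof (cases "T (Body (body r)) \<in> \<delta>")
      case False
      with \<delta> at_most_one obtain S where S: "S \<subseteq> {Pos (Val v i) | i. i \<in> {1..d}}" "card S = 2"
          and \<delta>_eq: "\<delta> = insert (F (Body (body r))) (holds ` S)"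
        by auto
      from S(2) obtain l l' where ll: "S = {l, l'}" "l \<noteq> l'" by (auto simp: card_2_iff)
      with S obtain i j where "l = Pos (Val v i)" "l' = Pos (Val v j)" by auto
      with ll show ?thesis unfolding \<delta>_eq by (intro inert_at_most_one[of v i _ j]) auto
    qed (use * at_most_one in auto)
  next
    case sat
    then have "\<delta> \<in> {{F (Body (Conj {Neg (Violate c)})), F (Atom (Violate c))},
        {T (Body (Conj {Neg (Violate c)})), T (Atom (Violate c))}}"
      using \<delta> by (auto simp: fails_def)
    then show ?thesis
      using inert_if_complement[of "F (Body (Conj {Neg (Violate c)}))" \<delta>]
        inert_if_complement[of "T (Atom (Violate c))" \<delta>] by auto
  next
    case violate
    then have "\<delta> \<in> {{F (Body (Conj {Neg (Sat c)})), F (Atom (Sat c))},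
        {T (Body (Conj {Neg (Sat c)})), T (Atom (Sat c))}}"
      using \<delta> by (auto simp: fails_def)
    then show ?thesis
      using inert_if_complement[of "T (Body (Conj {Neg (Sat c)}))" \<delta>]
        inert_if_complement[of "F (Atom (Sat c))" \<delta>] by auto
  next
    case (support v v' i)
    show ?thesis
    proof (cases "T (Body (body r)) \<in> \<delta>")
      case False
      with \<delta> support have \<delta>_eq: "\<delta> = insert (F (Body (body r)))
          (holds ` insert (Pos (Val v i)) {Neg (Val v' j) | j. j \<in> support d B v i v'})"
        by auto
      have "F (Atom (Val v' j)) \<in> \<delta>" if "j \<in> support d B v i v'" for j
        unfolding \<delta>_eq using that by (intro insertI2 image_eqI[of _ _ "Neg (Val v' j)"]) auto
      moreover have "T (Atom (Val v i)) \<in> \<delta>" unfolding \<delta>_eq by simp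
      ultimately show ?thesis
        using comp[of v v'] comp[of v' v] E support compatible_sym[of B v _ v']
        by (intro inert_support[of E v v' B d i]) auto
    qed (use * support in auto)
  qed
qed

text \<open>Apart from body nogoods: a head nogood has a true head or a false body, and a nogood
  demanding a supporting rule concerns either a false atom or an atom that has a rule with true
  body.\<close>

lemma inert_nogoods:
  assumes "binary_decomposition d c B" "\<forall>b\<in>B. arc_consistent E b"
    and E: "\<forall>v\<in>set (scope c). E v \<noteq> {} \<and> E v \<subseteq> {1..d}"
    and \<delta>: "\<delta> \<in> nogoods (support_encoding d c B)"
  shows "inert (ac_assignment c E) \<delta>"
proof -
  let ?P = "support_encoding d c B"
  consider (body) r where "r \<in> ?P" "\<delta> \<in> body_nogoods (body r)"
    | (head) h b where "\<delta> = {T (Body b), F (Atom h)}" "Rule h b \<in> ?P"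
    | (supp) a where "a \<in> atoms ?P"
        "\<delta> = insert (T (Atom a)) {F (Body (body r)) | r. r \<in> ?P \<and> a \<in> heads r}"
    | (bot) "\<delta> = {T (Atom Bot)}"
    using \<delta> unfolding nogoods_def by blast
  then show ?thesis
  proof cases
    case body
    then show ?thesis by (intro inert_body_nogoods[OF assms(1-3)])
  next
    case head
    show ?thesis
    proof (cases "h = Sat c")
      case True
      then show ?thesis using head by (intro inert_if_complement[of "F (Atom h)"]) auto
    next
      case False
      \<comment> \<open>Apart from choice rules, only the rule for \<open>Sat c\<close> has a body
        that is true in the assignment. For the at-least-one rule this relies again on d >=
        1.\<close>
      have "b \<noteq> Conj {} \<and> b \<noteq> Conj {Neg (Violate c)}" using head(2)
      proof (cases rule: support_encodingE)
        case (at_least_one v)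
        then obtain k where "k \<in> {1..d}" using E by blast
        then have "{Neg (Val v i) | i. i \<in> {1..d}} \<noteq> {}" by blast
        then show ?thesis using at_least_one by auto
      qed (use False in auto)
      then show ?thesis using head by (intro inert_if_complement[of "T (Body b)"]) auto
    qed
  next
    case supp
    have "(\<exists>v\<in>set (scope c). \<exists>i\<in>{1..d}. a = Val v i) \<or> a \<in> {Bot, Violate c, Sat c}"
    proof -
      obtain r where r: "r \<in> ?P" "a \<in> heads r \<union> atom_of ` literals (body r)"
        using supp(1) unfolding atoms_def by blast
      from r(1) show ?thesis
        by (cases rule: support_encodingE) (use r(2) in \<open>auto simp: support_def\<close>)
    qed
    then show ?thesis
    proof (elim disjE bexE)
      fix v i assume "v \<in> set (scope c)" "i \<in> {1..d}" "a = Val v i"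
      \<comment> \<open>Value atoms are supported by their choice rule, whose empty body is
        true.\<close>
      moreover from this have "Choice {Val v i | i. i \<in> {1..d}} (Conj {}) \<in> ?P"
        unfolding support_encoding_def value_rules_def by blast
      ultimately have "F (Body (Conj {})) \<in> \<delta>" unfolding supp(2) by force
      then show ?thesis by (rule inert_if_complement) auto
    next
      assume "a \<in> {Bot, Violate c, Sat c}"
      then consider "a \<in> {Bot, Violate c}" | "a = Sat c" by blast
      then show ?thesis
      proof cases
        case 1
        then show ?thesis using supp(2) by (intro inert_if_complement[of "T (Atom a)"]) auto
      next
        case 2
        have "Rule (Sat c) (Conj {Neg (Violate c)}) \<in> ?P" unfolding support_encoding_def by blast
        with 2 have "F (Body (Conj {Neg (Violate c)})) \<in> \<delta>" unfolding supp(2) by force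
        then show ?thesis by (rule inert_if_complement) auto
      qed
    qed
  next
    case bot
    then show ?thesis by (intro inert_if_complement) auto
  qed
qed

section \<open>Propagation of missing supports\<close>

lemma false_body_if_false_head:
  assumes "Rule h b \<in> P" "F (Atom h) \<in> unit_propagation (nogoods P) I"
  shows "F (Body b) \<in> unit_propagation (nogoods P) I"
proof -
  have "{T (Body b), F (Atom h)} \<in> nogoods P" using assms(1) unfolding nogoods_def by blast
  then show ?thesis using propagate[of _ _ "T (Body b)" I] assms(2) by auto
qed

lemma false_bot: "F (Atom Bot) \<in> unit_propagation (nogoods P) I"
proof -
  have "{T (Atom Bot)} \<in> nogoods P" unfolding nogoods_def by blast
  then show ?thesis using propagate[of _ _ "T (Atom Bot)" I] by auto
qed

lemma conj_nogood: "Rule h (Conj L) \<in> P \<Longrightarrow> insert (F (Body (Conj L))) (holds ` L) \<in> nogoods P"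
  unfolding nogoods_def by force

text \<open>Falsity of \<open>Violate c\<close> passes backwards to the body of the support rule.
  With all supports false, the only element of the body nogood left over is \<open>v = i\<close>,
  which propagation then refutes.\<close>

lemma false_value_if_no_support:
  assumes "v \<in> set (scope c)" "v' \<in> set (scope c)" "v \<noteq> v'" "i \<in> {1..d}"
    and A: "A = unit_propagation (nogoods (support_encoding d c B)) (initial_assignment d c D)"
    and "\<forall>j\<in>support d B v i v'. F (Atom (Val v' j)) \<in> A"
  shows "F (Atom (Val v i)) \<in> A"
proof -
  let ?L = "insert (Pos (Val v i)) {Neg (Val v' j) | j. j \<in> support d B v i v'}"
  have r: "Rule (Violate c) (Conj ?L) \<in> support_encoding d c B"
    using assms(1-4) unfolding support_encoding_def by blast
  have "F (Atom (Violate c)) \<in> A" unfolding A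
    by (rule initial) (simp add: initial_assignment_def)
  then have "F (Body (Conj ?L)) \<in> A"
    using false_body_if_false_head[OF r] unfolding A by blast
  then have "\<forall>y\<in>insert (F (Body (Conj ?L))) (holds ` ?L) - {T (Atom (Val v i))}. y \<in> A"
    using assms(6) by auto
  then show ?thesis
    using propagate[OF conj_nogood[OF r], of "T (Atom (Val v i))"] unfolding A by simp
qed

text \<open>The at-least-one body is false because its head \<open>Bot\<close> is, yet all its
  literals hold.\<close>

lemma conflict_if_all_values_false:
  assumes "v \<in> set (scope c)"
    and A: "A = unit_propagation (nogoods (support_encoding d c B)) I"
    and "\<forall>i\<in>{1..d}. F (Atom (Val v i)) \<in> A"
  shows "conflict (nogoods (support_encoding d c B)) A"
proof -
  let ?L = "{Neg (Val v i) | i. i \<in> {1..d}}"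
  have r: "Rule Bot (Conj ?L) \<in> support_encoding d c B"
    using assms(1) unfolding support_encoding_def value_rules_def by blast
  have "F (Body (Conj ?L)) \<in> A"
    using false_body_if_false_head[OF r false_bot] unfolding A .
  then have "insert (F (Body (Conj ?L))) (holds ` ?L) \<subseteq> A" using assms(3) by auto
  then show ?thesis using conj_nogood[OF r] unfolding conflict_def by blast
qed

lemma remaining_values_subset_enforce_ac:
  assumes dec: "binary_decomposition d c B"
    and A: "A = unit_propagation (nogoods (support_encoding d c B)) (initial_assignment d c D)"
    and v: "v \<in> set (scope c)"
  shows "{i \<in> {1..d}. F (Atom (Val v i)) \<notin> A} \<subseteq> enforce_ac B D v"
proof -
  define E where
    \<comment> \<open>\<open>enforce_ac\<close> compares domains at all variables, and
      \<open>D\<close> is arbitrary outside the scope; the empty set lies below it there and is not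
      touched by the constraints of \<open>B\<close>.\<close>
    "E = (\<lambda>v. if v \<in> set (scope c) then {i \<in> {1..d}. F (Atom (Val v i)) \<notin> A} else {})"
  have "E \<le> D"
  proof (intro le_funI subsetI)
    fix v i assume "i \<in> E v"
    then have i: "v \<in> set (scope c)" "i \<in> {1..d}" "F (Atom (Val v i)) \<notin> A"
      unfolding E_def by (auto split: if_splits)
    show "i \<in> D v"
    proof (rule ccontr)
      assume "i \<notin> D v"
      then have "F (Atom (Val v i)) \<in> initial_assignment d c D"
        using i unfolding initial_assignment_def by blast
      then show False using i(3) initial unfolding A by blast
    qed
  qed
  moreover have "\<forall>b\<in>B. arc_consistent E b"
    unfolding all_arc_consistent_iff[OF dec]
  proof (intro ballI impI)
    fix v v' i
    assume v: "v \<in> set (scope c)" "v' \<in> set (scope c)" "v \<noteq> v'" and i: "i \<in> E v"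
    then have "i \<in> {1..d}" "F (Atom (Val v i)) \<notin> A" unfolding E_def by auto
    \<comment> \<open>Contraposition: had all supports in \<open>v'\<close> been falsified,
      \<open>i\<close> would have been falsified too.\<close>
    then obtain j where "j \<in> support d B v i v'" "F (Atom (Val v' j)) \<notin> A"
      using false_value_if_no_support[OF v _ A] by blast
    then show "\<exists>j\<in>E v'. compatible B v i v' j" using v unfolding E_def support_def by auto
  qed
  ultimately have "E \<le> enforce_ac B D" by (rule le_enforce_ac)
  then have "E v \<subseteq> enforce_ac B D v" by (rule le_funD)
  then show ?thesis using v unfolding E_def by simp
qed

section \<open>Combination of the two inclusions\<close>

theorem theorem2:
  fixes d :: nat and c :: "'v constraint" and B :: "'v constraint set"
  assumes "is_constraint d c"
    and "binary_decomposition d c B"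
  shows "up_enforces_ac d c (support_encoding d c B) B"
  unfolding up_enforces_ac_def Let_def
proof (intro allI impI)
  fix D :: "'v \<Rightarrow> nat set"
  assume D: "\<forall>v\<in>set (scope c). D v \<noteq> {} \<and> D v \<subseteq> {1..d}"
  define N where "N = nogoods (support_encoding d c B)"
  define A where "A = unit_propagation N (initial_assignment d c D)"
  define E where "E = enforce_ac B D"
  let ?rem = "\<lambda>v. {i \<in> {1..d}. F (Atom (Val v i)) \<notin> A}"
  have A: "A = unit_propagation (nogoods (support_encoding d c B)) (initial_assignment d c D)"
    unfolding A_def N_def ..
  have ED: "E v \<subseteq> D v" for v using enforce_ac_le[of B D] unfolding E_def le_fun_def by blast
  \<comment> \<open>This inclusion holds whether or not a conflict arises, so it serves both for
    detecting failure and for the equality of domains.\<close>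
  have rem_E: "?rem v \<subseteq> E v" if "v \<in> set (scope c)" for v
    using remaining_values_subset_enforce_ac[OF assms(2) A that] unfolding E_def .
  have empty_conflict: "conflict N A" if "v \<in> set (scope c)" "E v = {}" for v
    unfolding N_def using rem_E[OF that(1)] that by (intro conflict_if_all_values_false[OF _ A]) auto
  have nonempty: "\<not> conflict N A \<and> (\<forall>v\<in>set (scope c). E v \<subseteq> ?rem v)"
    if ne: "\<forall>v\<in>set (scope c). E v \<noteq> {}"
  proof -
    have E: "\<forall>v\<in>set (scope c). E v \<noteq> {} \<and> E v \<subseteq> {1..d}" using ne D ED by blast
    let ?M = "ac_assignment c E"
    have "\<forall>b\<in>B. arc_consistent E b" unfolding E_def by (simp add: arc_consistent_enforce_ac)
    then have inert: "\<forall>\<delta>\<in>N. inert ?M \<delta>"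
      unfolding N_def using inert_nogoods[OF assms(2) _ E] by blast
    \<comment> \<open>Values outside \<open>D\<close> are outside \<open>E\<close>, hence false in
      \<open>?M\<close>.\<close>
    have I: "initial_assignment d c D \<subseteq> ?M"
      using subsetD[OF ED] unfolding initial_assignment_def by auto
    have "A \<subseteq> ?M"
      unfolding A_def by (rule unit_propagation_subset[OF I inert ac_assignment_consistent])
    then have "F (Atom (Val v i)) \<notin> A" if "i \<in> E v" for v i
      using that ac_assignment_simps(4)[of v i c E] by (metis subsetD)
    moreover have "\<not> conflict N A"
      unfolding A_def by (rule no_conflict_if_inert[OF I inert ac_assignment_consistent])
    ultimately show ?thesis using E by blast
  qed
  have "(conflict N A \<longleftrightarrow> (\<exists>v\<in>set (scope c). E v = {})) \<and>
      (\<not> conflict N A \<longrightarrow> (\<forall>v\<in>set (scope c). ?rem v = E v))"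
    \<comment> \<open>Without a conflict, \<open>empty_conflict\<close> makes every
      \<open>E v\<close> nonempty, and \<open>nonempty\<close> then supplies the inclusion converse
      to \<open>rem_E\<close>.\<close>
    using empty_conflict nonempty rem_E by blast
  then show "(conflict (nogoods (support_encoding d c B))
        (unit_propagation (nogoods (support_encoding d c B)) (initial_assignment d c D)) \<longleftrightarrow>
        (\<exists>v\<in>set (scope c). enforce_ac B D v = {})) \<and>
      (\<not> conflict (nogoods (support_encoding d c B))
        (unit_propagation (nogoods (support_encoding d c B)) (initial_assignment d c D)) \<longrightarrow>
        (\<forall>v\<in>set (scope c). {i \<in> {1..d}. F (Atom (Val v i)) \<notin>
          unit_propagation (nogoods (support_encoding d c B)) (initial_assignment d c D)} =
          enforce_ac B D v))"
    unfolding A_def N_def E_def .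
qed

end
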